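(* Let $\mathcal A$ be an associative unital $\mathbb C$-algebra, $A,B\in\mathcal A$, and $\alpha,\epsilon,\lambda\in\mathbb C$ with $\lambda\ne0$ and ($\alpha\ne0$ or $\epsilon\ne0$). Let $r,\rho$ be the two roots of $\alpha+\epsilon X-\lambda X^2$. Then the following are equivalent: (i) $[B,A]=\alpha+\epsilon A-\lambda A^2$; (ii) for all $t$, $e^{(A+B)t}=\Phi_A(\lambda t,r,\rho)^{1/\lambda}e^{Bt}$.
   Context: Scalars are identified with their multiples of $1_{\mathcal A}$; $[X,Y]=XY-YX$; $e^X=\sum_{n\ge0}X^n/n!$. For $A\in\mathcal A$ and scalars $t,x,y$, \[ \Phi_A(t,x,y):=\begin{cases}\dfrac{ye^{xt}-xe^{yt}}{y-x}+A\dfrac{e^{yt}-e^{xt}}{y-x}& x\ne y,\\[4pt] (1-xt)e^{xt}+Ate^{xt}& x=y.\end{cases} \] For $X$ (an algebra element or formal series in $t$ with algebra coefficients) and a scalar $\mu$, $X^\mu:=\sum_{k\ge0}(X-1)^k\binom{\mu}{k}$, $\binom{\mu}{k}=\mu(\mu-1)\cdots(\mu-k+1)/k!$. Series are treated formally; identities in $t$ are equalities of formal power series in $t$. *)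

theory Defs
  imports "HOL-Computational_Algebra.Computational_Algebra"
begin

(* Complex analogue of the library class real_algebra_1 (no topology on the algebra). *)
class complex_algebra_1 = ring_1 +
  fixes scaleC :: "complex \<Rightarrow> 'a \<Rightarrow> 'a"  (infixr "*\<^sub>C" 75)
  assumes scaleC_add_right: "a *\<^sub>C (x + y) = a *\<^sub>C x + a *\<^sub>C y"
    and scaleC_add_left: "(a + b) *\<^sub>C x = a *\<^sub>C x + b *\<^sub>C x"
    and scaleC_scaleC: "a *\<^sub>C b *\<^sub>C x = (a * b) *\<^sub>C x"
    and scaleC_one: "1 *\<^sub>C x = x"
    and mult_scaleC_left: "(a *\<^sub>C x) * y = a *\<^sub>C (x * y)"
    and mult_scaleC_right: "x * (a *\<^sub>C y) = a *\<^sub>C (x * y)"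

instantiation fps :: (complex_algebra_1) complex_algebra_1
begin

definition scaleC_fps :: "complex \<Rightarrow> 'a fps \<Rightarrow> 'a fps" where
  "scaleC_fps c F = Abs_fps (\<lambda>n. c *\<^sub>C fps_nth F n)"

lemma scaleC_0_right_aux: "c *\<^sub>C (0::'a) = 0"
  using scaleC_add_right[of c "0::'a" 0] by simp

lemma scaleC_sum_aux: "c *\<^sub>C (\<Sum>i\<in>I. f i) = (\<Sum>i\<in>I. c *\<^sub>C (f i :: 'a))"
  by (induction I rule: infinite_finite_induct) (simp_all add: scaleC_0_right_aux scaleC_add_right)

instance
  by intro_classes
    (simp_all add: scaleC_fps_def fps_eq_iff scaleC_add_right scaleC_add_left scaleC_scaleC
      scaleC_one fps_mult_nth mult_scaleC_left mult_scaleC_right scaleC_sum_aux)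

end

lemma fps_nth_scaleC [simp]: "fps_nth (c *\<^sub>C F) n = c *\<^sub>C fps_nth F n"
  by (simp add: scaleC_fps_def)

(* The infinite sums below are taken in the library's (t-adic) topology on fps. The first is
   meaningful for series with constant coefficient 0, the second for series with constant
   coefficient 1; see summable_fexp_fps and summable_fpow_fps. *)

definition fexp :: "'a::complex_algebra_1 fps \<Rightarrow> 'a fps" where
  "fexp X = (\<Sum>n. (1 / fact n) *\<^sub>C X ^ n)"

definition fpow :: "'a::complex_algebra_1 fps \<Rightarrow> complex \<Rightarrow> 'a fps" where
  "fpow X \<mu> = (\<Sum>k. (\<mu> gchoose k) *\<^sub>C (X - 1) ^ k)"

(* The time argument T is a formal series, so that Phi at time (l t) is Phi A (l *\<^sub>C fps_X). *)
definition Phi :: "'a::complex_algebra_1 \<Rightarrow> 'a fps \<Rightarrow> complex \<Rightarrow> complex \<Rightarrow> 'a fps" where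
  "Phi A T x y =
    (if x \<noteq> y then
       (1 / (y - x)) *\<^sub>C (y *\<^sub>C fexp (x *\<^sub>C T) - x *\<^sub>C fexp (y *\<^sub>C T))
       + fps_const A * ((1 / (y - x)) *\<^sub>C (fexp (y *\<^sub>C T) - fexp (x *\<^sub>C T)))
     else (1 - x *\<^sub>C T) * fexp (x *\<^sub>C T) + fps_const A * T * fexp (x *\<^sub>C T))"

lemma fps_power_nth_eq_0:
  fixes Z :: "'a::ring_1 fps"
  assumes "fps_nth Z 0 = 0" and "n < k"
  shows "fps_nth (Z ^ k) n = 0"
  using assms(2)
proof (induction k arbitrary: n)
  case (Suc k)
  have "fps_nth Z i * fps_nth (Z ^ k) (n - i) = 0" if "i \<le> n" for i
    using that Suc assms(1) by (cases "i = 0") auto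
  then show ?case by (simp add: fps_mult_nth)
qed simp

lemma scaleC_power_sums_fps:
  fixes Z :: "'a::complex_algebra_1 fps"
  assumes "fps_nth Z 0 = 0"
  shows "(\<lambda>k. c k *\<^sub>C Z ^ k) sums Abs_fps (\<lambda>n. \<Sum>k\<le>n. c k *\<^sub>C fps_nth (Z ^ k) n)"
  unfolding sums_def
proof (rule tendsto_fpsI)
  fix n
  have "fps_nth (\<Sum>k<m. c k *\<^sub>C Z ^ k) n = (\<Sum>k\<le>n. c k *\<^sub>C fps_nth (Z ^ k) n)" if "n < m" for m
    unfolding fps_sum_nth fps_nth_scaleC
    by (rule sum.mono_neutral_right)
      (use that in \<open>auto simp: fps_power_nth_eq_0[OF assms] scaleC_0_right_aux\<close>)
  then show "\<forall>\<^sub>F m in sequentially. fps_nth (\<Sum>k<m. c k *\<^sub>C Z ^ k) n =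
      fps_nth (Abs_fps (\<lambda>n. \<Sum>k\<le>n. c k *\<^sub>C fps_nth (Z ^ k) n)) n"
    by (auto intro: eventually_mono[OF eventually_gt_at_top[of n]])
qed

lemma summable_fexp_fps:
  fixes X :: "'a::complex_algebra_1 fps"
  shows "fps_nth X 0 = 0 \<Longrightarrow> summable (\<lambda>n. (1 / fact n) *\<^sub>C X ^ n)"
  by (rule sums_summable[OF scaleC_power_sums_fps])

lemma summable_fpow_fps:
  fixes X :: "'a::complex_algebra_1 fps"
  shows "fps_nth X 0 = 1 \<Longrightarrow> summable (\<lambda>k. (\<mu> gchoose k) *\<^sub>C (X - 1) ^ k)"
  by (rule sums_summable[OF scaleC_power_sums_fps]) simp

end

theory Submission
  imports Defs
begin

text \<open>
  Let \<open>d F = F' - [B, F]\<close>, a derivation of the ring of power series. The series \<open>\<Phi> = \<Phi>\<^sub>A(\<lambda>t, r, \<rho>)\<close> has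
  the form \<open>u + A v\<close> with scalar series satisfying \<open>u' = \<alpha> v\<close> and \<open>v' = \<lambda> u + \<epsilon> v\<close>, so (i) gives
  \<open>d \<Phi> = \<lambda> A \<Phi>\<close>, which commutes with \<open>\<Phi>\<close>. The power rule for \<open>d\<close> then yields \<open>d F = A F\<close> for
  \<open>F = \<Phi>\<^bsup>1/\<lambda>\<^esup>\<close>, that is, \<open>F e\<^bsup>Bt\<^esup>\<close> solves \<open>H' = (A + B) H\<close>, \<open>H(0) = 1\<close>.
  Conversely, (i) is the equality of the coefficients of \<open>t\<^sup>2\<close> in (ii).
\<close>

section \<open>Scalars and cancellation in the algebra\<close>

global_interpretation scaleC: module "scaleC :: complex \<Rightarrow> 'a \<Rightarrow> 'a::complex_algebra_1"
  by standard (simp_all add: scaleC_add_right scaleC_add_left scaleC_scaleC scaleC_one)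

lemma of_nat_conv_scaleC: "of_nat n = of_nat n *\<^sub>C (1 :: 'a::complex_algebra_1)"
  by (induction n) (simp_all add: scaleC_add_left)

lemma of_nat_mult_conv_scaleC: "of_nat n * x = of_nat n *\<^sub>C (x :: 'a::complex_algebra_1)"
  by (subst of_nat_conv_scaleC) (simp add: mult_scaleC_left)

lemma scaleC_left_cancel:
  fixes x y :: "'a::complex_algebra_1"
  assumes "c \<noteq> 0"
  shows "c *\<^sub>C x = c *\<^sub>C y \<longleftrightarrow> x = y"
proof
  assume "c *\<^sub>C x = c *\<^sub>C y"
  then have "(1 / c) *\<^sub>C c *\<^sub>C x = (1 / c) *\<^sub>C c *\<^sub>C y" by simp
  then show "x = y" using assms by simp
qed simp

lemma scaleC_power: "(c *\<^sub>C x) ^ n = c ^ n *\<^sub>C (x :: 'a::complex_algebra_1) ^ n"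
  by (induction n) (simp_all add: mult_scaleC_left mult_scaleC_right mult.commute)

text \<open>A constant coefficient 1 makes \<open>P\<close> left invertible even when the
  coefficient ring is noncommutative.\<close>

lemma fps_mult_left_cancel_ring_1:
  fixes P F G :: "'a::ring_1 fps"
  assumes "fps_nth P 0 = 1" "P * F = P * G"
  shows "F = G"
proof -
  have "fps_left_inverse P 1 * P = 1" using assms(1) by (intro fps_left_inverse) simp
  then show ?thesis using assms(2) by (metis mult.assoc mult_1_left)
qed

section \<open>Coefficients of exponentials and powers; the linear differential equation\<close>

lemma fps_nth_fexp:
  assumes "fps_nth X 0 = 0"
  shows "fps_nth (fexp X) n = (\<Sum>k\<le>n. (1 / fact k) *\<^sub>C fps_nth (X ^ k) n)"
  unfolding fexp_def sums_unique[OF scaleC_power_sums_fps[OF assms], symmetric] by simp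

lemma fps_nth_fpow:
  assumes "fps_nth X 0 = 1"
  shows "fps_nth (fpow X \<mu>) n = (\<Sum>k\<le>n. (\<mu> gchoose k) *\<^sub>C fps_nth ((X - 1) ^ k) n)"
proof -
  have "fps_nth (X - 1) 0 = 0" using assms by simp
  from sums_unique[OF scaleC_power_sums_fps[OF this], symmetric] show ?thesis
    unfolding fpow_def by simp
qed

lemma fps_const_mult_X_power:
  "(fps_const C * fps_X) ^ k = fps_const ((C :: 'a::ring_1) ^ k) * fps_X ^ k"
proof (induction k)
  case (Suc k)
  have "(fps_const C * fps_X) ^ Suc k = fps_const C * (fps_X * fps_const (C ^ k)) * fps_X ^ k"
    by (simp only: power_Suc Suc mult.assoc)
  also have "\<dots> = fps_const C * (fps_const (C ^ k) * fps_X) * fps_X ^ k"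
    by (simp only: fps_mult_fps_X_commute)
  also have "\<dots> = (fps_const C * fps_const (C ^ k)) * fps_X ^ Suc k"
    by (simp only: mult.assoc power_Suc)
  finally show ?case by simp
qed simp

lemma fps_nth_fexp_const_mult_X:
  "fps_nth (fexp (fps_const C * fps_X)) n = (1 / fact n) *\<^sub>C C ^ n"
proof -
  have "(1 / fact k) *\<^sub>C fps_nth ((fps_const C * fps_X) ^ k) n =
      (if k = n then (1 / fact n) *\<^sub>C C ^ n else 0)" for k
    by (simp add: fps_const_mult_X_power fps_X_power_iff)
  then show ?thesis by (simp add: fps_nth_fexp)
qed

text \<open>Uniqueness for the initial value problem: the equation is the recursion
  \<open>(n + 1) h(n + 1) = C h(n)\<close> for the coefficients, which together with
  \<open>h(0) = 1\<close> forces \<open>h(n) = C ^ n / n!\<close>.\<close>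

lemma fps_deriv_eq_const_mult_imp_fexp:
  fixes H :: "'a::complex_algebra_1 fps"
  assumes "fps_deriv H = fps_const C * H" "fps_nth H 0 = 1"
  shows "H = fexp (fps_const C * fps_X)"
proof (rule fps_ext)
  fix n
  show "fps_nth H n = fps_nth (fexp (fps_const C * fps_X)) n"
    unfolding fps_nth_fexp_const_mult_X
  proof (induction n)
    case (Suc n)
    have "of_nat (Suc n) *\<^sub>C fps_nth H (Suc n) = C * fps_nth H n"
      using arg_cong[OF assms(1), of "\<lambda>G. fps_nth G n"]
      by (simp add: of_nat_mult_conv_scaleC del: of_nat_Suc)
    also have "\<dots> = (of_nat (Suc n) * (1 / fact (Suc n))) *\<^sub>C C ^ Suc n"
      unfolding Suc by (simp add: mult_scaleC_right del: of_nat_Suc)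
    finally have "of_nat (Suc n) *\<^sub>C fps_nth H (Suc n) =
        of_nat (Suc n) *\<^sub>C (1 / fact (Suc n)) *\<^sub>C C ^ Suc n"
      by (simp only: scaleC_scaleC)
    then show ?case
      by (subst (asm) scaleC_left_cancel) (simp_all only: of_nat_eq_0_iff nat.simps simp_thms)
  qed (use assms(2) in \<open>simp\<close>)
qed

lemma fps_deriv_fexp_const_mult_X:
  "fps_deriv (fexp (fps_const C * fps_X)) = fps_const C * fexp (fps_const C * fps_X)"
  by (rule fps_ext)
    (simp add: fps_nth_fexp_const_mult_X of_nat_mult_conv_scaleC mult_scaleC_right
      del: of_nat_Suc)

section \<open>Derivations and the power rule\<close>

text \<open>The Leibniz rule puts \<open>d Z\<close> at every position of the product; since it
  commutes with \<open>Z\<close>, all these terms are equal.\<close>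

lemma derivation_power:
  fixes Z :: "'a::ring_1"
  assumes "\<And>F G. d (F * G) = d F * G + F * d G" "Z * d Z = d Z * Z"
  shows "d (Z ^ Suc k) = of_nat (Suc k) * (d Z * Z ^ k)"
proof (induction k)
  case (Suc k)
  have "Z * (of_nat (Suc k) * (d Z * Z ^ k)) = of_nat (Suc k) * (d Z * Z ^ Suc k)"
    using assms(2) by (metis mult.assoc mult_of_nat_commute power_Suc)
  then have "d (Z ^ Suc (Suc k)) = d Z * Z ^ Suc k + of_nat (Suc k) * (d Z * Z ^ Suc k)"
    using assms(1)[of Z "Z ^ Suc k"] Suc by (simp del: of_nat_Suc)
  then show ?case by (simp add: distrib_right del: power_Suc)
qed simp

text \<open>The last but one assumption stands in for the \<open>t\<close>-adic continuity of the derivation.\<close>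

lemma derivation_fpow:
  fixes X :: "'a::complex_algebra_1 fps" and d :: "'a fps \<Rightarrow> 'a fps"
  assumes X0: "fps_nth X 0 = 1"
    and add: "\<And>F G. d (F + G) = d F + d G"
    and mult: "\<And>F G. d (F * G) = d F * G + F * d G"
    and scale: "\<And>c F. d (c *\<^sub>C F) = c *\<^sub>C d F"
    and loc: "\<And>F n. (\<And>i. i \<le> Suc n \<Longrightarrow> fps_nth F i = 0) \<Longrightarrow> fps_nth (d F) n = 0"
    and comm: "X * d X = d X * X"
  shows "X * d (fpow X \<mu>) = \<mu> *\<^sub>C (d X * fpow X \<mu>)"
proof -
  define Z where "Z = X - 1"
  define c where "c k = \<mu> gchoose k" for k
  define S where "S m = (\<Sum>k<m. c k *\<^sub>C Z ^ k)" for m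
  have Z0: "fps_nth Z 0 = 0" by (simp add: Z_def X0)
  have d1: "d 1 = 0" using mult[of 1 1] by simp
  have X: "X = Z + 1" by (simp add: Z_def)
  have dX: "d X = d Z" using add[of Z 1] d1 by (simp add: X)
  have comm': "Z * d Z = d Z * Z" using comm unfolding dX unfolding X by (simp add: algebra_simps)
  \<comment> \<open>\<open>Z ^ k\<close> has no terms below order \<open>k\<close>, so the partial
    sum is already exact at every index below \<open>m\<close>.\<close>
  have nth_S: "fps_nth (S m) n = fps_nth (fpow X \<mu>) n" if "n < m" for m n
    unfolding S_def fps_sum_nth fps_nth_scaleC fps_nth_fpow[OF X0] c_def Z_def[symmetric]
    by (rule sum.mono_neutral_right)
      (use that in \<open>auto simp: fps_power_nth_eq_0[OF Z0]\<close>)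
  have step: "X * (d Z * Z ^ m) = d Z * Z ^ m + d Z * Z ^ Suc m" for m
  proof -
    have "Z * (d Z * Z ^ m) = d Z * Z ^ Suc m" by (metis comm' mult.assoc power_Suc)
    then show ?thesis by (simp add: X algebra_simps)
  qed
  \<comment> \<open>Multiplication by \<open>X = 1 + Z\<close> spreads \<open>d Z * Z ^ k\<close>
    over two adjacent powers. The coefficients recombine by
    \<open>k * c k + (k + 1) * c (k + 1) = \<mu> * c k\<close>, so that only the top power remains
    as an error term.\<close>
  have S: "X * d (S (Suc m)) = \<mu> *\<^sub>C (d Z * S m) + (of_nat m * c m) *\<^sub>C (d Z * Z ^ m)" for m
  proof (induction m)
    case 0
    show ?case by (simp add: S_def scale d1)
  next
    case (Suc m)
    have rec: "of_nat m * c m + of_nat (Suc m) * c (Suc m) = \<mu> * c m"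
      unfolding c_def by (rule gbinomial_mult_1[symmetric])
    have "X * d (S (Suc (Suc m))) =
        X * d (S (Suc m)) + c (Suc m) *\<^sub>C (X * d (Z ^ Suc m))"
      by (simp add: S_def add scale distrib_left mult_scaleC_right del: power_Suc)
    also have "X * d (Z ^ Suc m) = of_nat (Suc m) *\<^sub>C (X * (d Z * Z ^ m))"
      unfolding derivation_power[of d Z m, OF mult comm']
      by (simp add: of_nat_mult_conv_scaleC mult_scaleC_right del: of_nat_Suc)
    also have "X * d (S (Suc m)) + c (Suc m) *\<^sub>C of_nat (Suc m) *\<^sub>C (X * (d Z * Z ^ m)) =
        \<mu> *\<^sub>C (d Z * S m) + (of_nat m * c m + of_nat (Suc m) * c (Suc m)) *\<^sub>C (d Z * Z ^ m)
        + (of_nat (Suc m) * c (Suc m)) *\<^sub>C (d Z * Z ^ Suc m)"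
      unfolding Suc step
      by (simp add: scaleC_add_left scaleC_add_right mult.commute del: of_nat_Suc power_Suc)
    also have "\<dots> = \<mu> *\<^sub>C (d Z * S (Suc m))
        + (of_nat (Suc m) * c (Suc m)) *\<^sub>C (d Z * Z ^ Suc m)"
      unfolding rec
      by (simp add: S_def distrib_left mult_scaleC_right scaleC_add_right
          del: of_nat_Suc power_Suc)
    finally show ?case .
  qed
  show ?thesis
  proof (rule fps_ext)
    fix n
    let ?m = "Suc n"
    \<comment> \<open>The truncation goes one order beyond \<open>n\<close> because \<open>d\<close>
      may lower the order by one: \<open>R\<close> vanishes up to index \<open>n + 1\<close>, hence
      \<open>d R\<close> up to index \<open>n\<close>. The error term contains
      \<open>Z ^ (n + 1)\<close> and is invisible at index \<open>n\<close>.\<close>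
    define R where "R = fpow X \<mu> - S (Suc ?m)"
    have R: "fpow X \<mu> = S (Suc ?m) + R" by (simp add: R_def)
    have "fps_nth (d R) i = 0" if "i \<le> n" for i
      using that by (intro loc) (simp add: R_def nth_S)
    then have "fps_nth (X * d R) n = 0" by (simp add: fps_mult_nth)
    then have "fps_nth (X * d (fpow X \<mu>)) n = fps_nth (X * d (S (Suc ?m))) n"
      by (simp add: R add distrib_left)
    also have "\<dots> = \<mu> *\<^sub>C fps_nth (d Z * S ?m) n"
      unfolding S by (simp add: fps_mult_nth fps_power_nth_eq_0[OF Z0] del: of_nat_Suc power_Suc)
    also have "fps_nth (d Z * S ?m) n = fps_nth (d Z * fpow X \<mu>) n"
      by (simp add: fps_mult_nth nth_S)
    finally show "fps_nth (X * d (fpow X \<mu>)) n = fps_nth (\<mu> *\<^sub>C (d X * fpow X \<mu>)) n"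
      by (simp add: dX)
  qed
qed

section \<open>Power series with scalar coefficients\<close>

text \<open>The embedding of the complex power series into the center of the power series over the
  algebra. Computations with the scalar parts of \<open>Phi\<close> can thus take place in a
  commutative ring.\<close>

definition fps_scalar :: "complex fps \<Rightarrow> 'a::complex_algebra_1 fps" where
  "fps_scalar f = Abs_fps (\<lambda>n. fps_nth f n *\<^sub>C 1)"

lemma fps_nth_fps_scalar [simp]: "fps_nth (fps_scalar f) n = fps_nth f n *\<^sub>C 1"
  by (simp add: fps_scalar_def)

lemma fps_scalar_1: "fps_scalar 1 = 1"
  by (rule fps_ext) simp

lemma fps_scalar_add: "fps_scalar (f + g) = fps_scalar f + fps_scalar g"
  by (rule fps_ext) (simp add: scaleC_add_left)

lemma fps_scalar_diff: "fps_scalar (f - g) = fps_scalar f - fps_scalar g"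
  by (rule fps_ext) (simp add: scaleC.scale_left_diff_distrib)

lemma fps_scalar_mult: "fps_scalar (f * g) = fps_scalar f * fps_scalar g"
  by (rule fps_ext)
    (simp add: fps_mult_nth scaleC.scale_sum_left mult_scaleC_left mult_scaleC_right mult.commute)

lemma fps_scalar_const: "fps_scalar (fps_const c) = c *\<^sub>C 1"
  by (rule fps_ext) simp

lemma fps_scalar_X: "fps_scalar fps_X = fps_X"
  by (rule fps_ext) (simp add: fps_X_def)

lemma fps_deriv_fps_scalar: "fps_deriv (fps_scalar f) = fps_scalar (fps_deriv f)"
  by (rule fps_ext) (simp add: of_nat_mult_conv_scaleC del: of_nat_Suc)

lemma fps_scalar_commute: "fps_scalar f * G = G * fps_scalar f"
proof (rule fps_ext)
  fix n
  have "fps_nth (fps_scalar f * G) n = (\<Sum>i=0..n. fps_nth f i *\<^sub>C fps_nth G (n - i))"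
    by (simp add: fps_mult_nth mult_scaleC_left)
  also have "\<dots> = (\<Sum>i=0..n. fps_nth f (n - i) *\<^sub>C fps_nth G i)"
    by (rule sum.reindex_bij_witness[of _ "\<lambda>i. n - i" "\<lambda>i. n - i"]) auto
  also have "\<dots> = fps_nth (G * fps_scalar f) n"
    by (simp add: fps_mult_nth mult_scaleC_right)
  finally show "fps_nth (fps_scalar f * G) n = fps_nth (G * fps_scalar f) n" .
qed

lemma fexp_scaleC_X: "fexp (c *\<^sub>C fps_X) = fps_scalar (fps_exp c)"
proof -
  have "c *\<^sub>C fps_X = fps_const (c *\<^sub>C 1 :: 'a) * fps_X"
    by (rule fps_ext) (simp add: mult_scaleC_left)
  then show ?thesis
    by (intro fps_ext) (simp add: fps_nth_fexp_const_mult_X scaleC_power)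
qed

section \<open>The series \<open>Phi\<close> and the roots of the quadratic\<close>

text \<open>The distinct and the double root case satisfy the same linear system, so no case
  distinction is needed afterwards. Its coefficients are symmetric in \<open>x\<close> and
  \<open>y\<close>, ready for Vieta's formulas.\<close>

lemma Phi_decomposition:
  fixes A :: "'a::complex_algebra_1"
  obtains u v where
    "Phi A (l *\<^sub>C fps_X) x y = fps_scalar u + fps_const A * fps_scalar v"
    "fps_deriv u = fps_const (- l * x * y) * v"
    "fps_deriv v = fps_const l * u + fps_const (l * (x + y)) * v"
    "fps_nth u 0 = 1" "fps_nth v 0 = 0"
proof (cases "x = y")
  case False
  let ?ex = "fps_exp (x * l)" and ?ey = "fps_exp (y * l)"
  define k where "k = 1 / (y - x)"
  have k: "k * (y - x) = 1" using False by (simp add: k_def)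
  define u where "u = fps_const k * (fps_const y * ?ex - fps_const x * ?ey)"
  define v where "v = fps_const k * (?ey - ?ex)"
  show ?thesis
  proof
    show "Phi A (l *\<^sub>C fps_X) x y = fps_scalar u + fps_const A * fps_scalar v"
      using False
      by (simp add: Phi_def u_def v_def k_def fexp_scaleC_X fps_scalar_mult
          fps_scalar_const fps_scalar_diff mult_scaleC_left)
    show "fps_deriv u = fps_const (- l * x * y) * v"
      unfolding u_def v_def by (rule fps_ext) (simp add: algebra_simps)
    show "fps_deriv v = fps_const l * u + fps_const (l * (x + y)) * v"
      unfolding u_def v_def by (rule fps_ext) (simp add: algebra_simps add_divide_distrib)
    show "fps_nth u 0 = 1" "fps_nth v 0 = 0"
      using k by (simp_all add: u_def v_def)
  qed
next
  case True
  let ?e = "fps_exp (x * l)"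
  define u where "u = (1 - fps_const (x * l) * fps_X) * ?e"
  define v where "v = fps_const l * fps_X * ?e"
  show ?thesis
  proof
    show "Phi A (l *\<^sub>C fps_X) x y = fps_scalar u + fps_const A * fps_scalar v"
      using True
      by (simp add: Phi_def u_def v_def fexp_scaleC_X fps_scalar_mult fps_scalar_const
          fps_scalar_diff fps_scalar_1 fps_scalar_X mult_scaleC_left mult.assoc)
    show "fps_deriv u = fps_const (- l * x * y) * v"
      unfolding u_def v_def
      \<comment> \<open>Constants are split into their factors so that \<open>algebra_simps\<close>
        can collect and cancel the terms.\<close>
      by (simp add: True algebra_simps fps_const_mult[symmetric] fps_const_neg[symmetric]
          del: fps_const_mult fps_const_neg)
    show "fps_deriv v = fps_const l * u + fps_const (l * (x + y)) * v"
      unfolding u_def v_def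
      by (simp add: True algebra_simps fps_const_mult[symmetric] fps_const_add[symmetric]
          del: fps_const_mult fps_const_add)
    show "fps_nth u 0 = 1" "fps_nth v 0 = 0" by (simp_all add: u_def v_def)
  qed
qed

text \<open>Vieta's formulas. The multiset counts a double root twice, so the polynomial is its
  leading coefficient times both linear factors.\<close>

lemma proots_quadratic:
  fixes a b c x y :: complex
  assumes "c \<noteq> 0" "proots [:a, b, c:] = {#x, y#}"
  shows "a = c * x * y" "b = - c * (x + y)"
proof -
  have "[:a, b, c:] = smult c ([:-x, 1:] * [:-y, 1:])"
    using complex_poly_decompose_multiset[of "[:a, b, c:]"] assms by simp
  then show "a = c * x * y" "b = - c * (x + y)"
    by (simp_all add: algebra_simps)
qed

section \<open>Equivalence of the commutator relation and the exponential formula\<close>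

theorem theorem3p2:
  fixes A B :: "'a::complex_algebra_1"
    and \<alpha> \<epsilon> l r \<rho> :: complex
  assumes "l \<noteq> 0"
    and "\<alpha> \<noteq> 0 \<or> \<epsilon> \<noteq> 0"
    and "proots [:\<alpha>, \<epsilon>, - l:] = {#r, \<rho>#}"
  shows "B * A - A * B = \<alpha> *\<^sub>C 1 + \<epsilon> *\<^sub>C A - l *\<^sub>C A ^ 2 \<longleftrightarrow>
    fexp (fps_const (A + B) * fps_X) =
      fpow (Phi A (l *\<^sub>C fps_X) r \<rho>) (1 / l) * fexp (fps_const B * fps_X)"
proof -
  have \<alpha>: "\<alpha> = - l * r * \<rho>" and \<epsilon>: "\<epsilon> = l * (r + \<rho>)"
    using proots_quadratic[OF _ assms(3)] \<open>l \<noteq> 0\<close> by simp_all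
  define P where "P = Phi A (l *\<^sub>C fps_X) r \<rho>"
  obtain u v where P: "P = fps_scalar u + fps_const A * fps_scalar v"
    and u': "fps_deriv u = fps_const \<alpha> * v"
    and v': "fps_deriv v = fps_const l * u + fps_const \<epsilon> * v"
    and u0: "fps_nth u 0 = 1" and v0: "fps_nth v 0 = 0"
    unfolding P_def \<alpha> \<epsilon> by (rule Phi_decomposition)
  define F where "F = fpow P (1 / l)"
  define E where "E = fexp (fps_const B * fps_X)"
  have P0: "fps_nth P 0 = 1" by (simp add: P u0 v0)
  have F0: "fps_nth F 0 = 1" by (simp add: F_def fps_nth_fpow[OF P0])
  have E0: "fps_nth E 0 = 1" by (simp add: E_def fps_nth_fexp_const_mult_X)
  have P': "fps_deriv P = \<alpha> *\<^sub>C fps_scalar v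
      + fps_const A * (l *\<^sub>C fps_scalar u + \<epsilon> *\<^sub>C fps_scalar v)"
    by (simp add: P fps_deriv_fps_scalar u' v' fps_scalar_add fps_scalar_mult
        fps_scalar_const mult_scaleC_left)
  have "fexp (fps_const (A + B) * fps_X) = F * E"
    if comm: "B * A - A * B = \<alpha> *\<^sub>C 1 + \<epsilon> *\<^sub>C A - l *\<^sub>C A ^ 2"
  proof -
    define d where "d G = fps_deriv G - (fps_const B * G - G * fps_const B)" for G :: "'a fps"
    have d_mult: "d (G * H) = d G * H + G * d H" for G H
      by (simp add: d_def algebra_simps)
    \<comment> \<open>Scalar series are central, so \<open>[B, P]\<close> is \<open>v\<close> times
      \<open>[B, A]\<close>. After inserting the relation, the \<alpha> and \<epsilon> terms cancel
      against those of \<open>P'\<close>, leaving \<open>l (A u + A^2 v)\<close>.\<close>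
    have dP: "d P = l *\<^sub>C (fps_const A * P)"
    proof (rule fps_ext)
      fix n
      let ?u = "fps_nth u n" and ?v = "fps_nth v n"
      have "fps_nth (fps_const B * P - P * fps_const B) n = ?v *\<^sub>C (B * A - A * B)"
        by (simp add: P distrib_left distrib_right mult_scaleC_left mult_scaleC_right
            scaleC.scale_right_diff_distrib)
      then have "fps_nth (d P) n = \<alpha> *\<^sub>C ?v *\<^sub>C 1 + A * (l *\<^sub>C ?u *\<^sub>C 1 + \<epsilon> *\<^sub>C ?v *\<^sub>C 1)
          - ?v *\<^sub>C (\<alpha> *\<^sub>C 1 + \<epsilon> *\<^sub>C A - l *\<^sub>C A ^ 2)"
        unfolding d_def comm by (simp add: P')
      also have "\<dots> = fps_nth (l *\<^sub>C (fps_const A * P)) n"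
        by (simp add: P distrib_left mult_scaleC_right scaleC_add_right
            scaleC.scale_right_diff_distrib power2_eq_square mult.commute)
      finally show "fps_nth (d P) n = fps_nth (l *\<^sub>C (fps_const A * P)) n" .
    qed
    have AP: "fps_const A * P = P * fps_const A"
      by (simp add: P distrib_left distrib_right fps_scalar_commute mult.assoc)
    have "P * d F = (1 / l) *\<^sub>C (d P * F)"
      unfolding F_def
    proof (rule derivation_fpow[OF P0 _ d_mult])
      show "d (G + H) = d G + d H" for G H by (simp add: d_def algebra_simps)
      show "d (c *\<^sub>C G) = c *\<^sub>C d G" for c G
        by (rule fps_ext) (simp add: d_def of_nat_mult_conv_scaleC mult_scaleC_left
            mult_scaleC_right scaleC.scale_right_diff_distrib mult.commute del: of_nat_Suc)
      show "fps_nth (d G) n = 0" if "\<And>i. i \<le> Suc n \<Longrightarrow> fps_nth G i = 0" for G n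
        by (simp add: d_def that)
      show "P * d P = d P * P"
        by (simp add: dP mult_scaleC_left mult_scaleC_right) (metis AP mult.assoc)
    qed
    \<comment> \<open>The exponent \<open>1 / l\<close> absorbs the factor \<open>l\<close> of
      \<open>d P\<close>; as \<open>A\<close> commutes with \<open>P\<close>, the factor
      \<open>P\<close> moves to the left and can be cancelled.\<close>
    also have "\<dots> = P * (fps_const A * F)"
      using \<open>l \<noteq> 0\<close> by (simp add: dP mult_scaleC_left AP mult.assoc)
    finally have "d F = fps_const A * F"
      by (rule fps_mult_left_cancel_ring_1[OF P0])
    then have F': "fps_deriv F = fps_const (A + B) * F - F * fps_const B"
      by (simp add: d_def algebra_simps fps_const_add[symmetric] del: fps_const_add)
    \<comment> \<open>The term \<open>- F * B\<close> in \<open>F'\<close> cancels against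
      \<open>F * E' = F * B * E\<close>.\<close>
    have "fps_deriv (F * E) = fps_const (A + B) * (F * E)"
      by (simp add: F' E_def fps_deriv_fexp_const_mult_X algebra_simps)
    then show ?thesis
      using fps_deriv_eq_const_mult_imp_fexp[of "F * E" "A + B"] by (simp add: F0 E0)
  qed
  moreover have "B * A - A * B = \<alpha> *\<^sub>C 1 + \<epsilon> *\<^sub>C A - l *\<^sub>C A ^ 2"
    if eq: "fexp (fps_const (A + B) * fps_X) = F * E"
  proof -
    have P1: "fps_nth P (Suc 0) = l *\<^sub>C A"
      using arg_cong[OF P', of "\<lambda>G. fps_nth G 0"] by (simp add: u0 v0 mult_scaleC_right)
    have u1: "fps_nth u (Suc 0) = 0" using arg_cong[OF u', of "\<lambda>G. fps_nth G 0"] by (simp add: v0)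
    have v1: "fps_nth v (Suc 0) = l"
      using arg_cong[OF v', of "\<lambda>G. fps_nth G 0"] by (simp add: u0 v0)
    have P2: "2 *\<^sub>C fps_nth P 2 = (\<alpha> * l) *\<^sub>C 1 + (\<epsilon> * l) *\<^sub>C A"
      using arg_cong[OF P', of "\<lambda>G. fps_nth G 1"] of_nat_mult_conv_scaleC[of 2 "fps_nth P 2"]
      by (simp add: u1 v1 mult_scaleC_right numeral_2_eq_2)
    have F1: "fps_nth F (Suc 0) = A"
      using \<open>l \<noteq> 0\<close> P1 by (simp add: F_def fps_nth_fpow[OF P0])
    \<comment> \<open>Second coefficients are doubled throughout to clear the denominator 2.\<close>
    have c2: "2 * (\<mu> gchoose 2) = \<mu> * (\<mu> - 1)" for \<mu> :: complex
      by (simp add: gbinomial_prod_rev numeral_2_eq_2)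
    \<comment> \<open>\<open>P - 1\<close> has no constant term, so only its first and second powers
      contribute to this coefficient.\<close>
    have "fps_nth F 2 = (1 / l) *\<^sub>C fps_nth P 2 + (1 / l gchoose 2) *\<^sub>C (l *\<^sub>C A) ^ 2"
      by (simp add: F_def fps_nth_fpow[OF P0] fps_mult_nth P0 P1 numeral_2_eq_2)
    then have "2 *\<^sub>C fps_nth F 2 = (1 / l) *\<^sub>C 2 *\<^sub>C fps_nth P 2
        + (2 * (1 / l gchoose 2) * l ^ 2) *\<^sub>C A ^ 2"
      by (simp add: scaleC_power scaleC_add_right mult.assoc)
    also have "\<dots> = \<alpha> *\<^sub>C 1 + \<epsilon> *\<^sub>C A + (1 - l) *\<^sub>C A ^ 2"
    proof -
      have "2 * (1 / l gchoose 2) * l ^ 2 = 1 - l"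
        unfolding c2 using \<open>l \<noteq> 0\<close> by (simp add: power2_eq_square field_simps)
      then show ?thesis
        unfolding P2 using \<open>l \<noteq> 0\<close> by (simp add: scaleC_add_right)
    qed
    finally have F2: "2 *\<^sub>C fps_nth F 2 = \<alpha> *\<^sub>C 1 + \<epsilon> *\<^sub>C A + (A ^ 2 - l *\<^sub>C A ^ 2)"
      by (simp add: scaleC.scale_left_diff_distrib)
    have E1: "fps_nth E (Suc 0) = B" and E2: "2 *\<^sub>C fps_nth E 2 = B ^ 2"
      by (simp_all add: E_def fps_nth_fexp_const_mult_X)
    \<comment> \<open>Twice the coefficient of \<open>t^2\<close> on both sides: \<open>A^2\<close>
      and \<open>B^2\<close> cancel, and \<open>A B + B A\<close> against \<open>2 A B\<close>
      leaves the commutator.\<close>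
    have "(A + B) ^ 2 = 2 *\<^sub>C fps_nth (F * E) 2"
      unfolding eq[symmetric] fps_nth_fexp_const_mult_X by simp
    also have "fps_nth (F * E) 2 = fps_nth E 2 + A * B + fps_nth F 2"
      by (simp add: fps_mult_nth F0 E0 F1 E1 numeral_2_eq_2)
    also have "2 *\<^sub>C \<dots> = B ^ 2 + (A * B + A * B) + 2 *\<^sub>C fps_nth F 2"
      using scaleC_add_left[of 1 1 "A * B"] by (simp add: scaleC_add_right E2)
    finally show ?thesis
      unfolding F2 by (simp add: power2_eq_square algebra_simps)
  qed
  ultimately show ?thesis unfolding F_def E_def P_def by blast
qed

end
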